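(* Let $M\in\mathbb{R}$ and let $\Delta^n_{\mathbf{0},M}=\{x\in\mathbb{R}^n: x\ge 0,\ e^\top x\le M\}$. Let $F\in \mathbb{R}[x]$, $x=(x_1,\dots,x_n)$, be a polynomial of degree at most $d$ such that $F(x)>0$ for all $x\in\Delta^n_{\mathbf{0},M}$. Then there exist $n$-variate SOS polynomials $\sigma_{0}$ and $\sigma_1$, and univariate SOS polynomials $\rho_1,\dots,\rho_{n}, \rho_{n+1}$ such that $$F(x) = \sigma_0(x)+\sigma_1(x)\left( M^2-\|x\|^2 - (M-e^\top x)^2 \right) + \rho_{n+1}(M-e^\top x)\,(M-e^\top x) + \sum_{i=1}^{n} \rho_i(x_i)\,x_i .$$
   Context: $e$ is the all-ones vector, so $e^\top x=\sum_i x_i$; $\|x\|$ is the Euclidean norm. A polynomial is SOS if it is a finite sum of squares of real polynomials. *)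

theory Defs
  imports
    "HOL-Analysis.Analysis"
    "HOL-Library.Poly_Mapping"
    "HOL-Computational_Algebra.Polynomial"
begin

text \<open>
  Elements of \<open>\<real>[x]\<close>, with one variable for each element of the finite index type
  \<open>'n\<close>: finitely supported maps from exponent vectors to coefficients. The ring
  operations on this type are those of \<open>Poly_Mapping\<close> (convolution product).
\<close>
type_synonym 'n mpoly = "('n \<Rightarrow>\<^sub>0 nat) \<Rightarrow>\<^sub>0 real"

definition mconst :: "real \<Rightarrow> 'n mpoly" where
  "mconst c = Poly_Mapping.single 0 c"

definition mvar :: "'n \<Rightarrow> 'n mpoly" where
  "mvar i = Poly_Mapping.single (Poly_Mapping.single i 1) 1"

definition monom_degree :: "('n::finite \<Rightarrow>\<^sub>0 nat) \<Rightarrow> nat" where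
  "monom_degree m = (\<Sum>i\<in>UNIV. Poly_Mapping.lookup m i)"

text \<open>The zero polynomial gets degree \<open>0\<close>.\<close>
definition total_degree :: "('n::finite) mpoly \<Rightarrow> nat" where
  "total_degree p = Max (insert 0 (monom_degree ` Poly_Mapping.keys p))"

definition meval :: "('n::finite) mpoly \<Rightarrow> real ^ 'n \<Rightarrow> real" where
  "meval p x = (\<Sum>m\<in>Poly_Mapping.keys p.
     Poly_Mapping.lookup p m * (\<Prod>i\<in>UNIV. (x $ i) ^ Poly_Mapping.lookup m i))"

text \<open>\<open>msubst r q\<close> is the multivariate polynomial \<open>r(q)\<close>, for univariate \<open>r\<close>.\<close>
definition msubst :: "real poly \<Rightarrow> 'n mpoly \<Rightarrow> 'n mpoly" where
  "msubst r q = poly (map_poly mconst r) q"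

text \<open>Used both for \<open>'n mpoly\<close> and for the univariate \<open>real poly\<close>.\<close>
definition is_sos :: "'a::comm_ring_1 \<Rightarrow> bool" where
  "is_sos p \<longleftrightarrow> (\<exists>qs. p = (\<Sum>q\<leftarrow>qs. q ^ 2))"

definition corner_simplex :: "real \<Rightarrow> (real ^ 'n) set" where
  "corner_simplex M = {x. (\<forall>i. 0 \<le> x $ i) \<and> (\<Sum>i\<in>UNIV. x $ i) \<le> M}"

text \<open>The polynomial \<open>M - e\<^sup>T x\<close>.\<close>
definition slack :: "real \<Rightarrow> ('n::finite) mpoly" where
  "slack M = mconst M - (\<Sum>i\<in>UNIV. mvar i)"

end

theory Submission
  imports Defs
begin

text \<open>
  Write \<open>g\<close> for the ball constraint \<open>M\<^sup>2 - \<parallel>x\<parallel>\<^sup>2 - (M - e\<^sup>T x)\<^sup>2\<close>. The multipliers of the linear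
  constraints have to be univariate, and the idea is to choose them first, as
  penalties. On a compact set where \<open>\<bar>t\<bar> \<le> C\<close>, the function \<open>t (1 - t / C)\<^bsup>2N\<^esup>\<close> becomes
  uniformly small for \<open>t \<ge> 0\<close> and tends to \<open>-\<infinity>\<close> for \<open>t < 0\<close>. Let \<open>t\<close> run through the
  variables, the slack and also \<open>g\<close>. Every point at which all of these are
  nonnegative lies in the simplex, so for large \<open>N\<close> subtracting the penalties from \<open>F\<close>
  leaves a polynomial \<open>G\<close> that is positive on the whole box \<open>[-R, R]\<^sup>n\<close>, where \<open>R = \<bar>M\<bar> + 1\<close>
  (\<open>penalized_pos_on_compact\<close>). The subtracted terms have the form
  \<open>\<rho>(t) t\<close> with \<open>\<rho>\<close> a univariate square.

  It remains to see that \<open>G = \<sigma> + \<tau> g\<close> with sums of squares \<open>\<sigma>\<close> and \<open>\<tau>\<close>. The polynomials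
  of this form are closed under sums and, since there is only one generator,
  under products (\<open>sos_module_mult\<close>). They include the nonnegative constants and,
  by an explicit identity, the polynomials \<open>R \<plusminus> x\<^sub>i\<close> (\<open>box_bound_in_sos_module\<close>).
  In high degree the Bernstein coefficients of \<open>G\<close> on the box approach its values at
  the nodes and are therefore nonnegative, which exhibits \<open>G\<close> as a sum of products
  of such polynomials (\<open>positive_on_box_in_cone\<close>).
\<close>

section \<open>Evaluation and substitution\<close>

lemma mconst_0 [simp]: "mconst 0 = 0"
  by (simp add: mconst_def)

lemma mconst_1 [simp]: "mconst 1 = 1"
  by (simp add: mconst_def)

lemma mconst_add: "mconst (a + b) = mconst a + mconst b"
  by (simp add: mconst_def single_add)

lemma mconst_uminus: "mconst (- a) = - mconst a"
  by (simp add: mconst_def single_uminus)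

lemma mconst_diff: "mconst (a - b) = mconst a - mconst b"
  by (simp add: mconst_def single_diff)

lemma mconst_mult: "mconst (a * b) = mconst a * mconst b"
  by (simp add: mconst_def mult_single)

lemma mconst_power: "mconst (a ^ k) = mconst a ^ k"
  by (induction k) (simp_all add: mconst_mult)

lemma mconst_sum: "mconst (sum f A) = (\<Sum>x\<in>A. mconst (f x))"
  by (induction A rule: infinite_finite_induct) (simp_all add: mconst_add)

lemma mconst_prod: "mconst (prod f A) = (\<Prod>x\<in>A. mconst (f x))"
  by (induction A rule: infinite_finite_induct) (simp_all add: mconst_mult)

lemma poly_mapping_eq_sum_single:
  "p = (\<Sum>k\<in>Poly_Mapping.keys p. Poly_Mapping.single k (Poly_Mapping.lookup p k))"
  by (rule poly_mapping_eqI)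
     (simp add: lookup_sum lookup_single when_def in_keys_iff)

lemma single_one_eq_prod_mvar:
  fixes m :: "'n::finite \<Rightarrow>\<^sub>0 nat"
  shows "Poly_Mapping.single m (1::real) = (\<Prod>i\<in>UNIV. mvar i ^ Poly_Mapping.lookup m i)"
proof -
  have power: "mvar i ^ k = Poly_Mapping.single (Poly_Mapping.single i k) (1::real)" for i :: 'n and k
    by (induction k) (simp_all add: mvar_def mult_single single_add [symmetric])
  have prod: "(\<Prod>i\<in>A. Poly_Mapping.single (f i) (1::real)) = Poly_Mapping.single (\<Sum>i\<in>A. f i) 1"
    for f :: "'n \<Rightarrow> 'n \<Rightarrow>\<^sub>0 nat" and A
    by (induction A rule: infinite_finite_induct) (simp_all add: mult_single)
  have "(\<Sum>i\<in>UNIV. Poly_Mapping.single i (Poly_Mapping.lookup m i)) = m"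
    by (rule poly_mapping_eqI) (simp add: lookup_sum lookup_single when_def)
  then show ?thesis
    by (simp add: power prod)
qed

lemma mpoly_eq_sum_monomials:
  fixes p :: "('n::finite) mpoly"
  shows "p = (\<Sum>m\<in>Poly_Mapping.keys p.
    mconst (Poly_Mapping.lookup p m) * (\<Prod>i\<in>UNIV. mvar i ^ Poly_Mapping.lookup m i))"
  by (subst poly_mapping_eq_sum_single)
     (simp add: single_one_eq_prod_mvar [symmetric] mconst_def mult_single)

lemma meval_eq_sum_superset:
  assumes "finite A" "Poly_Mapping.keys p \<subseteq> A"
  shows "meval p x = (\<Sum>m\<in>A. Poly_Mapping.lookup p m * (\<Prod>i\<in>UNIV. (x $ i) ^ Poly_Mapping.lookup m i))"
  unfolding meval_def using assms
  by (intro sum.mono_neutral_left) (auto simp: in_keys_iff)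

lemma meval_0 [simp]: "meval 0 x = 0"
  by (simp add: meval_def)

lemma meval_add: "meval (p + q) x = meval p x + meval q x"
proof -
  let ?A = "Poly_Mapping.keys p \<union> Poly_Mapping.keys q"
  have "Poly_Mapping.keys (p + q) \<subseteq> ?A"
    by (rule keys_add)
  then show ?thesis
    by (simp add: meval_eq_sum_superset [where A = ?A] lookup_add sum.distrib distrib_right)
qed

lemma meval_uminus: "meval (- p) x = - meval p x"
  by (simp add: meval_def sum_negf)

lemma meval_diff: "meval (p - q) x = meval p x - meval q x"
  using meval_add [of p "- q" x] by (simp add: meval_uminus)

lemma meval_sum: "meval (sum f A) x = (\<Sum>a\<in>A. meval (f a) x)"
  by (induction A rule: infinite_finite_induct) (simp_all add: meval_add)

lemma meval_single:
  "meval (Poly_Mapping.single m c) x = c * (\<Prod>i\<in>UNIV. (x $ i) ^ Poly_Mapping.lookup m i)"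
  by (simp add: meval_eq_sum_superset [where A = "{m}"])

text \<open>
  Both arguments are split into their terms because the value of a single term
  is multiplicative by inspection of exponents, whereas the coefficients of a
  convolution product are awkward to sum directly.
\<close>

lemma meval_mult: "meval (p * q) x = meval p x * meval q x"
proof -
  let ?s = "\<lambda>p k. Poly_Mapping.single k (Poly_Mapping.lookup p k)"
  have "p * q = (\<Sum>k\<in>Poly_Mapping.keys p. ?s p k) * (\<Sum>l\<in>Poly_Mapping.keys q. ?s q l)"
    by (simp flip: poly_mapping_eq_sum_single)
  also have "\<dots> = (\<Sum>k\<in>Poly_Mapping.keys p. \<Sum>l\<in>Poly_Mapping.keys q. ?s p k * ?s q l)"
    by (rule sum_product)
  also have "meval \<dots> x = (\<Sum>k\<in>Poly_Mapping.keys p. \<Sum>l\<in>Poly_Mapping.keys q. 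
      meval (?s p k) x * meval (?s q l) x)"
    by (simp add: meval_sum mult_single meval_single lookup_add power_add prod.distrib algebra_simps)
  also have "\<dots> = meval p x * meval q x"
    unfolding sum_product [symmetric] by (simp add: meval_single) (simp add: meval_def)
  finally show ?thesis .
qed

lemma meval_mconst [simp]: "meval (mconst c) x = c"
  by (simp add: mconst_def meval_single)

lemma meval_1 [simp]: "meval 1 x = 1"
  using meval_mconst [of 1] by simp

lemma meval_power: "meval (p ^ k) x = meval p x ^ k"
  by (induction k) (simp_all add: meval_mult)

lemma meval_mvar [simp]: "meval (mvar i) x = x $ i"
proof -
  have "(\<Prod>j\<in>UNIV. (x $ j) ^ Poly_Mapping.lookup (Poly_Mapping.single i 1) j) = (\<Prod>j\<in>{i}. x $ j)"
    by (rule prod.mono_neutral_cong_right) (auto simp: lookup_single when_def)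
  then show ?thesis
    by (simp add: mvar_def meval_single)
qed

lemma continuous_on_meval: "continuous_on S (meval p)"
  unfolding meval_def by (intro continuous_intros)

lemma msubst_0 [simp]: "msubst 0 q = 0"
  by (simp add: msubst_def)

lemma msubst_pCons: "msubst (pCons a r) q = mconst a + q * msubst r q"
  by (cases "r = 0 \<and> a = 0") (auto simp: msubst_def map_poly_pCons)

lemma msubst_1 [simp]: "msubst 1 q = 1"
  by (simp add: one_pCons msubst_pCons)

lemma msubst_add: "msubst (r + s) q = msubst r q + msubst s q"
  by (induction r s rule: poly_induct2) (simp_all add: msubst_pCons mconst_add algebra_simps)

lemma msubst_smult: "msubst (smult c r) q = mconst c * msubst r q"
  by (induction r) (simp_all add: msubst_pCons mconst_mult algebra_simps)

lemma msubst_mult: "msubst (r * s) q = msubst r q * msubst s q"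
  by (induction r) (simp_all add: msubst_pCons msubst_add msubst_smult algebra_simps)

lemma msubst_power: "msubst (r ^ k) q = msubst r q ^ k"
  by (induction k) (simp_all add: msubst_mult)

section \<open>Sums of squares\<close>

lemma is_sos_power2: "is_sos (q ^ 2)"
  unfolding is_sos_def by (rule exI [of _ "[q]"]) simp

lemma is_sos_0: "is_sos 0"
  unfolding is_sos_def by (rule exI [of _ "[]"]) simp

lemma is_sos_add:
  assumes "is_sos p" "is_sos q"
  shows "is_sos (p + q)"
proof -
  obtain ps qs where "p = (\<Sum>r\<leftarrow>ps. r ^ 2)" "q = (\<Sum>r\<leftarrow>qs. r ^ 2)"
    using assms unfolding is_sos_def by blast
  then have "p + q = (\<Sum>r\<leftarrow>ps @ qs. r ^ 2)" by simp
  then show ?thesis unfolding is_sos_def by blast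
qed

lemma is_sos_sum: "(\<And>a. a \<in> A \<Longrightarrow> is_sos (f a)) \<Longrightarrow> is_sos (sum f A)"
  by (induction A rule: infinite_finite_induct) (auto simp: is_sos_0 is_sos_add)

lemma is_sos_mult:
  assumes "is_sos p" "is_sos q"
  shows "is_sos (p * q)"
proof -
  have square: "is_sos (a ^ 2 * (\<Sum>r\<leftarrow>qs. r ^ 2))" for a :: 'a and qs
    by (induction qs) (simp_all add: is_sos_0 is_sos_add is_sos_power2 distrib_left flip: power_mult_distrib)
  have "is_sos ((\<Sum>r\<leftarrow>ps. r ^ 2) * q)" for ps
  proof -
    obtain qs where "q = (\<Sum>r\<leftarrow>qs. r ^ 2)"
      using assms(2) unfolding is_sos_def by blast
    then show ?thesis
      by (induction ps) (simp_all add: is_sos_0 is_sos_add square distrib_right)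
  qed
  then show ?thesis
    using assms(1) unfolding is_sos_def [of p] by blast
qed

lemma is_sos_mconst: "c \<ge> 0 \<Longrightarrow> is_sos (mconst c)"
  using is_sos_power2 [of "mconst (sqrt c)"] by (simp flip: mconst_power)

text \<open>
  The quadratic module generated by the single element \<open>g\<close>.
\<close>

definition sos_module :: "'a::comm_ring_1 \<Rightarrow> 'a set" where
  "sos_module g = {\<sigma> + \<tau> * g | \<sigma> \<tau>. is_sos \<sigma> \<and> is_sos \<tau>}"

lemma sos_moduleI: "is_sos \<sigma> \<Longrightarrow> is_sos \<tau> \<Longrightarrow> \<sigma> + \<tau> * g \<in> sos_module g"
  by (auto simp: sos_module_def)

lemma is_sos_in_sos_module: "is_sos \<sigma> \<Longrightarrow> \<sigma> \<in> sos_module g"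
  using sos_moduleI [of \<sigma> 0 g] by (simp add: is_sos_0)

lemma generator_in_sos_module: "g \<in> sos_module g"
  using sos_moduleI [of 0 "1 ^ 2" g] is_sos_power2 [of 1] by (simp add: is_sos_0)

lemma sos_module_add:
  assumes "p \<in> sos_module g" "q \<in> sos_module g"
  shows "p + q \<in> sos_module g"
proof -
  obtain a b c d where *: "is_sos a" "is_sos b" "is_sos c" "is_sos d" "p = a + b * g" "q = c + d * g"
    using assms by (auto simp: sos_module_def)
  have "p + q = (a + c) + (b + d) * g"
    by (simp add: * algebra_simps)
  then show ?thesis
    using * by (metis sos_moduleI is_sos_add)
qed

text \<open>
  Quadratic modules are in general not closed under products. With one
  generator they are, because the only new product of generators is \<open>g\<^sup>2\<close>, which is
  itself a square.
\<close>

lemma sos_module_mult: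
  assumes "p \<in> sos_module g" "q \<in> sos_module g"
  shows "p * q \<in> sos_module g"
proof -
  obtain a b c d where *: "is_sos a" "is_sos b" "is_sos c" "is_sos d" "p = a + b * g" "q = c + d * g"
    using assms by (auto simp: sos_module_def)
  have "p * q = (a * c + (b * d) * g\<^sup>2) + (a * d + b * c) * g"
    by (simp add: * algebra_simps power2_eq_square)
  then show ?thesis
    using * by (metis sos_moduleI is_sos_add is_sos_mult is_sos_power2)
qed

section \<open>Bernstein expansions on a box\<close>

text \<open>
  The degree-\<open>N\<close> Bernstein coefficient with index \<open>k\<close> of the \<open>a\<close>-th power of the affine
  form that is \<open>\<alpha>\<close> at \<open>(u, v) = (1, 0)\<close> and \<open>\<beta>\<close> at \<open>(0, 1)\<close>. The recursion comes from
  multiplying an expansion of degree \<open>N - 1\<close> by \<open>\<alpha> u + \<beta> v\<close> and comparing with the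
  binomial coefficients of degree \<open>N\<close>. The value at \<open>k - 1\<close> when \<open>k = 0\<close>, and the value of
  degree \<open>N - 1\<close> at \<open>k\<close> when \<open>k = N > 0\<close>, belong to no term of the lower expansion; both are
  multiplied by \<open>0\<close>.
\<close>

fun bernstein_coeff :: "real \<Rightarrow> real \<Rightarrow> nat \<Rightarrow> nat \<Rightarrow> nat \<Rightarrow> real" where
  "bernstein_coeff \<alpha> \<beta> 0 N k = 1"
| "bernstein_coeff \<alpha> \<beta> (Suc a) N k =
     \<alpha> * (real k / real N) * bernstein_coeff \<alpha> \<beta> a (N - 1) (k - 1)
   + \<beta> * (1 - real k / real N) * bernstein_coeff \<alpha> \<beta> a (N - 1) k"

text \<open>
  For \<open>a = 0\<close> this is the binomial theorem for \<open>1 = (u + v)\<^sup>N\<close>, and each further factor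
  raises the degree of the expansion by one.
\<close>

lemma power_bernstein_expansion:
  fixes u v :: "'n mpoly"
  assumes uv: "u + v = 1" and "a \<le> N"
  shows "(mconst \<alpha> * u + mconst \<beta> * v) ^ a =
    (\<Sum>k\<le>N. mconst (bernstein_coeff \<alpha> \<beta> a N k) * (of_nat (N choose k) * u ^ k * v ^ (N - k)))"
  using \<open>a \<le> N\<close>
proof (induction a arbitrary: N)
  case 0
  then show ?case
    using binomial_ring [of u v N] by (simp add: uv)
next
  case (Suc a)
  then obtain K where N: "N = Suc K" and "a \<le> K"
    by (cases N) auto
  let ?x = "mconst \<alpha> * u + mconst \<beta> * v"
  let ?e = "bernstein_coeff \<alpha> \<beta> a K"
  have of_nat: "of_nat j = mconst (real j)" for j
    by (induction j) (simp_all add: mconst_add)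
  \<comment> \<open>The contributions of the factors \<open>\<alpha> u\<close> (in \<open>f\<close>, with a shift of the index) and \<open>\<beta> v\<close> (in \<open>h\<close>) to the term with index \<open>k\<close>.\<close>
  define f where "f k = (if k = 0 then 0 else mconst (\<alpha> * ?e (k - 1) * real (K choose (k - 1))) * (u ^ k * v ^ (N - k)))" for k
  define h where "h k = mconst (\<beta> * ?e k * real (K choose k)) * (u ^ k * v ^ (N - k))" for k
  have split: "mconst (bernstein_coeff \<alpha> \<beta> (Suc a) N k) * (of_nat (N choose k) * u ^ k * v ^ (N - k))
      = f k + h k" if "k \<le> N" for k
  proof -
    have 1: "real k / real N * real (N choose k) = (if k = 0 then 0 else real (K choose (k - 1)))"
    proof (cases k)
      case (Suc j)
      have "real (Suc j) * real (Suc K choose Suc j) = real (Suc K) * real (K choose j)"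
        using Suc_times_binomial_eq [of K j] by (metis mult.commute of_nat_mult)
      then show ?thesis using Suc by (simp add: N field_simps del: binomial_Suc_Suc of_nat_Suc)
    qed simp
    have 2: "(1 - real k / real N) * real (N choose k) = real (K choose k)"
    proof (cases k)
      case (Suc j)
      then show ?thesis using 1 by (simp add: N left_diff_distrib)
    qed (simp add: N)
    have "bernstein_coeff \<alpha> \<beta> (Suc a) N k * real (N choose k)
      = \<alpha> * ?e (k - 1) * (real k / real N * real (N choose k))
        + \<beta> * ?e k * ((1 - real k / real N) * real (N choose k))"
      by (simp add: N algebra_simps)
    then have "bernstein_coeff \<alpha> \<beta> (Suc a) N k * real (N choose k)
      = (if k = 0 then 0 else \<alpha> * ?e (k - 1) * real (K choose (k - 1))) + \<beta> * ?e k * real (K choose k)"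
      unfolding 1 2 by simp
    then have "mconst (bernstein_coeff \<alpha> \<beta> (Suc a) N k * real (N choose k)) * (u ^ k * v ^ (N - k)) = f k + h k"
      by (auto simp: f_def h_def mconst_add distrib_right)
    then show ?thesis
      by (simp only: of_nat mconst_mult mult.assoc)
  qed
  have f: "(\<Sum>k\<le>N. f k) = mconst \<alpha> * u * (\<Sum>k\<le>K. mconst (?e k) * (of_nat (K choose k) * u ^ k * v ^ (K - k)))"
    by (simp add: N sum.atMost_Suc_shift f_def sum_distrib_left mconst_mult of_nat algebra_simps
             del: sum.atMost_Suc binomial_Suc_Suc)
  have h: "(\<Sum>k\<le>N. h k) = mconst \<beta> * v * (\<Sum>k\<le>K. mconst (?e k) * (of_nat (K choose k) * u ^ k * v ^ (K - k)))"
  proof -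
    have "h k = mconst \<beta> * v * (mconst (?e k) * (of_nat (K choose k) * u ^ k * v ^ (K - k)))" if "k \<le> K" for k
      using that by (simp add: N h_def mconst_mult of_nat Suc_diff_le algebra_simps)
    moreover have "h N = 0"
      by (simp add: h_def N binomial_eq_0)
    ultimately show ?thesis
      by (simp add: N sum_distrib_left del: binomial_Suc_Suc)
  qed
  have "?x ^ Suc a = ?x * (\<Sum>k\<le>K. mconst (?e k) * (of_nat (K choose k) * u ^ k * v ^ (K - k)))"
    using Suc.IH [OF \<open>a \<le> K\<close>] by simp
  also have "\<dots> = (\<Sum>k\<le>N. f k) + (\<Sum>k\<le>N. h k)"
    by (simp add: f h distrib_right)
  also have "\<dots> = (\<Sum>k\<le>N. mconst (bernstein_coeff \<alpha> \<beta> (Suc a) N k) * (of_nat (N choose k) * u ^ k * v ^ (N - k)))"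
    by (simp add: split sum.distrib [symmetric] del: bernstein_coeff.simps)
  finally show ?case .
qed

text \<open>
  In high degree the coefficient with index \<open>k\<close> is close to the value of the expanded
  power at the node \<open>u = k/N\<close>. The recursion shows this along any sequence of nodes
  that converges: passing from \<open>(N, k)\<close> to \<open>(N - 1, k - 1)\<close> or \<open>(N - 1, k)\<close> does not
  change the limit of \<open>k/N\<close>.
\<close>

lemma bernstein_coeff_tendsto:
  fixes N k :: "nat \<Rightarrow> nat"
  assumes "filterlim N at_top sequentially" "(\<lambda>j. real (k j) / real (N j)) \<longlonglongrightarrow> s"
  shows "(\<lambda>j. bernstein_coeff \<alpha> \<beta> a (N j) (k j)) \<longlonglongrightarrow> (\<alpha> * s + \<beta> * (1 - s)) ^ a"
  using assms
proof (induction a arbitrary: N k)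
  case 0
  then show ?case by simp
next
  case (Suc a)
  note N = Suc.prems(1) and k = Suc.prems(2)
  have s: "s \<ge> 0"
    using k by (rule LIMSEQ_le_const) auto
  have N1: "filterlim (\<lambda>j. N j - 1) at_top sequentially"
    unfolding filterlim_at_top
  proof
    fix Z
    have "eventually (\<lambda>j. N j \<ge> Suc Z) sequentially"
      using N unfolding filterlim_at_top by blast
    then show "eventually (\<lambda>j. N j - 1 \<ge> Z) sequentially"
      by eventually_elim simp
  qed
  have ev: "eventually (\<lambda>j. N j \<ge> 2) sequentially"
    using N by (simp add: filterlim_at_top)
  have inv: "(\<lambda>j. 1 / real (N j)) \<longlonglongrightarrow> 0"
    using N by (intro tendsto_divide_0 [OF tendsto_const] filterlim_at_top_imp_at_infinity
        filterlim_compose [OF filterlim_real_sequentially])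
  have "(\<lambda>j. max (real (k j) / real (N j) - 1 / real (N j)) 0 / (1 - 1 / real (N j))) \<longlonglongrightarrow> max (s - 0) 0 / (1 - 0)"
    by (intro tendsto_intros k inv) simp
  moreover have "eventually (\<lambda>j. max (real (k j) / real (N j) - 1 / real (N j)) 0 / (1 - 1 / real (N j))
      = real (k j - 1) / real (N j - 1)) sequentially"
    using ev
  proof eventually_elim
    case (elim j)
    have "max (real (k j) / real (N j) - 1 / real (N j)) 0 = real (k j - 1) / real (N j)"
      using elim by (cases "k j") (auto simp: field_simps max_def)
    then show ?case using elim by (simp add: field_simps of_nat_diff)
  qed
  ultimately have k1: "(\<lambda>j. real (k j - 1) / real (N j - 1)) \<longlonglongrightarrow> s"
    using s by (auto elim: Lim_transform_eventually)
  have "(\<lambda>j. (real (k j) / real (N j)) / (1 - 1 / real (N j))) \<longlonglongrightarrow> s / (1 - 0)"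
    by (intro tendsto_intros k inv) simp
  moreover have "eventually (\<lambda>j. (real (k j) / real (N j)) / (1 - 1 / real (N j))
      = real (k j) / real (N j - 1)) sequentially"
    using ev by eventually_elim (simp add: field_simps of_nat_diff)
  ultimately have k2: "(\<lambda>j. real (k j) / real (N j - 1)) \<longlonglongrightarrow> s"
    by (auto elim: Lim_transform_eventually)
  have "(\<lambda>j. bernstein_coeff \<alpha> \<beta> (Suc a) (N j) (k j)) \<longlonglongrightarrow>
     \<alpha> * s * (\<alpha> * s + \<beta> * (1 - s)) ^ a + \<beta> * (1 - s) * (\<alpha> * s + \<beta> * (1 - s)) ^ a"
    unfolding bernstein_coeff.simps
    by (intro tendsto_intros k Suc.IH [OF N1 k1] Suc.IH [OF N1 k2])
  then show ?case by (simp add: algebra_simps)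
qed

text \<open>
  The tensor product Bernstein expansion of \<open>p\<close> in the normalised forms
  \<open>u\<^sub>i = (R + x\<^sub>i) / 2R\<close> and \<open>v\<^sub>i = (R - x\<^sub>i) / 2R\<close>, whose sum is \<open>1\<close>, has nonnegative coefficients
  in some degree, and then all its terms lie in \<open>T\<close>. Indeed, if in every large degree
  some coefficient were negative, the corresponding nodes would accumulate at a point
  of the box, where by \<open>bernstein_coeff_tendsto\<close> the polynomial would have a value \<open>\<le> 0\<close>.
\<close>

lemma positive_on_box_in_cone:
  fixes p :: "('n::finite) mpoly" and T :: "'n mpoly set"
  assumes add: "\<And>a b. a \<in> T \<Longrightarrow> b \<in> T \<Longrightarrow> a + b \<in> T"
    and mult: "\<And>a b. a \<in> T \<Longrightarrow> b \<in> T \<Longrightarrow> a * b \<in> T"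
    and const: "\<And>c. c \<ge> 0 \<Longrightarrow> mconst c \<in> T"
    and plus: "\<And>i. mconst R + mvar i \<in> T"
    and minus: "\<And>i. mconst R - mvar i \<in> T"
    and R: "R > 0"
    and pos: "\<And>x. (\<forall>i. \<bar>x $ i\<bar> \<le> R) \<Longrightarrow> meval p x > 0"
  shows "p \<in> T"
proof -
  have sum: "sum f A \<in> T" if "\<And>a. a \<in> A \<Longrightarrow> f a \<in> T" for A :: "'b set" and f
    using that const [of 0] by (induction A rule: infinite_finite_induct) (auto intro: add)
  have prod: "prod f A \<in> T" if "\<And>a. a \<in> A \<Longrightarrow> f a \<in> T" for A :: "'b set" and f
    using that const [of 1] by (induction A rule: infinite_finite_induct) (auto intro: mult)
  have power: "a ^ k \<in> T" if "a \<in> T" for a k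
    using that const [of 1] by (induction k) (auto intro: mult)
  define u where "u i = mconst (1 / (2 * R)) * (mconst R + mvar i)" for i :: 'n
  define v where "v i = mconst (1 / (2 * R)) * (mconst R - mvar i)" for i :: 'n
  have uvT: "u i \<in> T" "v i \<in> T" for i
    using R by (auto simp: u_def v_def intro!: mult const plus minus)
  have half: "mconst (1 / (2 * R)) * mconst R + mconst (1 / (2 * R)) * mconst R = (1 :: 'n mpoly)"
    using R by (simp flip: mconst_mult mconst_add)
  have uv: "u i + v i = 1" for i
  proof -
    have "u i + v i = mconst (1 / (2 * R)) * mconst R + mconst (1 / (2 * R)) * mconst R"
      by (simp add: u_def v_def algebra_simps)
    then show ?thesis
      by (simp only: half)
  qed
  have mvar_eq: "mvar i = mconst R * u i + mconst (- R) * v i" for i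
  proof -
    have "mconst R * u i + mconst (- R) * v i =
        (mconst (1 / (2 * R)) * mconst R + mconst (1 / (2 * R)) * mconst R) * mvar i"
      by (simp add: u_def v_def mconst_uminus algebra_simps)
    then show ?thesis
      by (simp only: half mult_1_left)
  qed
  define e where "e = bernstein_coeff R (- R)"
  \<comment> \<open>A crude bound on all exponents: from degree \<open>D\<close> on, every power of a variable that occurs has a Bernstein expansion.\<close>
  define D where "D = (\<Sum>m\<in>Poly_Mapping.keys p. \<Sum>i\<in>UNIV. Poly_Mapping.lookup m i)"
  have D: "Poly_Mapping.lookup m i \<le> D" if "m \<in> Poly_Mapping.keys p" for m and i :: 'n
  proof -
    have "Poly_Mapping.lookup m i \<le> (\<Sum>i\<in>UNIV. Poly_Mapping.lookup m i)"
      by (rule member_le_sum) auto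
    also have "\<dots> \<le> D"
      unfolding D_def using that by (intro member_le_sum) auto
    finally show ?thesis .
  qed
  define c where "c N \<kappa> = (\<Sum>m\<in>Poly_Mapping.keys p. Poly_Mapping.lookup p m *
    (\<Prod>i\<in>UNIV. e (Poly_Mapping.lookup m i) N (\<kappa> i)))" for N and \<kappa> :: "'n \<Rightarrow> nat"
  define B where "B N i k = of_nat (N choose k) * u i ^ k * v i ^ (N - k)" for N k and i :: 'n
  have expand: "p = (\<Sum>\<kappa>\<in>PiE UNIV (\<lambda>_. {..N}). mconst (c N \<kappa>) * (\<Prod>i\<in>UNIV. B N i (\<kappa> i)))"
    if "D \<le> N" for N
  proof -
    let ?l = "Poly_Mapping.lookup" and ?P = "PiE UNIV (\<lambda>_::'n. {..N})"
    have "p = (\<Sum>m\<in>Poly_Mapping.keys p. mconst (?l p m) * (\<Prod>i\<in>UNIV. mvar i ^ ?l m i))"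
      by (rule mpoly_eq_sum_monomials)
    also have "\<dots> = (\<Sum>m\<in>Poly_Mapping.keys p. mconst (?l p m) *
        (\<Prod>i\<in>UNIV. \<Sum>k\<le>N. mconst (e (?l m i) N k) * B N i k))"
    proof (intro sum.cong prod.cong refl arg_cong2 [where f = "(*)"])
      fix m and i :: 'n
      assume "m \<in> Poly_Mapping.keys p"
      then have "?l m i \<le> N" using D [of m i] that by simp
      then show "mvar i ^ ?l m i = (\<Sum>k\<le>N. mconst (e (?l m i) N k) * B N i k)"
        unfolding mvar_eq [of i] e_def B_def by (rule power_bernstein_expansion [OF uv])
    qed
    also have "\<dots> = (\<Sum>m\<in>Poly_Mapping.keys p. \<Sum>\<kappa>\<in>?P.
        mconst (?l p m * (\<Prod>i\<in>UNIV. e (?l m i) N (\<kappa> i))) * (\<Prod>i\<in>UNIV. B N i (\<kappa> i)))"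
      by (simp add: prod_sum_PiE sum_distrib_left mconst_mult mconst_prod prod.distrib mult.assoc)
    also have "\<dots> = (\<Sum>\<kappa>\<in>?P. mconst (c N \<kappa>) * (\<Prod>i\<in>UNIV. B N i (\<kappa> i)))"
      by (subst sum.swap) (simp add: c_def mconst_sum sum_distrib_right)
    finally show ?thesis .
  qed
  have "\<exists>N\<ge>D. \<forall>\<kappa>\<in>PiE UNIV (\<lambda>_. {..N}). c N \<kappa> \<ge> 0"
  proof (rule ccontr)
    assume contr: "\<not> ?thesis"
    have "\<exists>\<kappa>. (\<forall>i. \<kappa> i \<le> Suc (D + j)) \<and> c (Suc (D + j)) \<kappa> < 0" for j
    proof -
      have "\<not> (\<forall>\<kappa>\<in>PiE UNIV (\<lambda>_. {..Suc (D + j)}). c (Suc (D + j)) \<kappa> \<ge> 0)"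
        using contr by (metis le_SucI le_add1)
      then show ?thesis
        by (auto simp: PiE_iff not_le)
    qed
    then obtain \<kappa> where \<kappa>: "\<And>j i. \<kappa> j i \<le> Suc (D + j)" "\<And>j. c (Suc (D + j)) (\<kappa> j) < 0"
      by metis
    define y :: "nat \<Rightarrow> real ^ 'n" where "y j = (\<chi> i. real (\<kappa> j i) / real (Suc (D + j)))" for j
    define Q :: "(real ^ 'n) set" where "Q = cbox 0 (\<chi> i. 1)"
    have "seq_compact Q"
      by (simp add: Q_def compact_imp_seq_compact)
    moreover have "\<forall>j. y j \<in> Q"
      using \<kappa>(1) by (auto simp: Q_def y_def mem_box_cart divide_simps simp flip: of_nat_Suc of_nat_add)
    ultimately obtain s r where s: "s \<in> Q" and r: "strict_mono r" and lim: "(y \<circ> r) \<longlonglongrightarrow> s"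
      by (rule seq_compactE)
    define N where "N j = Suc (D + r j)" for j
    have N: "filterlim N at_top sequentially"
      unfolding filterlim_at_top N_def
    proof
      fix Z
      show "eventually (\<lambda>j. Suc (D + r j) \<ge> Z) sequentially"
        using eventually_ge_at_top [of Z]
      proof eventually_elim
        case (elim j)
        then show ?case using seq_suble [OF r, of j] by simp
      qed
    qed
    have lim_i: "(\<lambda>j. real (\<kappa> (r j) i) / real (N j)) \<longlonglongrightarrow> s $ i" for i
      using tendsto_vec_nth [OF lim, of i] by (simp add: y_def N_def o_def)
    \<comment> \<open>The point of the original box whose normalised coordinates \<open>u\<^sub>i\<close> are the limits \<open>s\<^sub>i\<close>.\<close>
    define x where "x = (\<chi> i. R * s $ i + - R * (1 - s $ i))"
    have "(\<lambda>j. c (N j) (\<kappa> (r j))) \<longlonglongrightarrow> meval p x"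
      unfolding c_def meval_def e_def x_def vec_lambda_beta
      by (intro tendsto_intros bernstein_coeff_tendsto N lim_i)
    moreover have "c (N j) (\<kappa> (r j)) \<le> 0" for j
      using \<kappa>(2) [of "r j"] by (simp add: N_def)
    ultimately have "meval p x \<le> 0"
      by (intro LIMSEQ_le_const2) auto
    moreover have "\<bar>x $ i\<bar> \<le> R" for i
    proof -
      have "0 \<le> s $ i" "s $ i \<le> 1"
        using s by (auto simp: Q_def mem_box_cart)
      moreover have "x $ i = R * (2 * s $ i - 1)"
        by (simp add: x_def algebra_simps)
      ultimately show ?thesis
        using R by (simp add: abs_mult abs_le_iff mult_left_le)
    qed
    ultimately show False
      using pos [of x] by force
  qed
  then obtain N where "D \<le> N" and nonneg: "\<And>\<kappa>. \<kappa> \<in> PiE UNIV (\<lambda>_. {..N}) \<Longrightarrow> c N \<kappa> \<ge> 0"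
    by blast
  have of_nat: "of_nat k \<in> T" for k
    using const [of 0] const [of 1] by (induction k) (auto intro: add)
  have "(\<Sum>\<kappa>\<in>PiE UNIV (\<lambda>_. {..N}). mconst (c N \<kappa>) * (\<Prod>i\<in>UNIV. B N i (\<kappa> i))) \<in> T"
    unfolding B_def by (intro sum prod mult const nonneg power uvT of_nat)
  then show ?thesis
    using expand [OF \<open>D \<le> N\<close>] by simp
qed

section \<open>Penalising violated constraints\<close>

text \<open>
  Both halves of the estimate are Bernoulli's inequality. For \<open>s = t / C \<in> [0, 1]\<close> it
  gives \<open>(1 + m s) (1 - s)\<^sup>m \<le> (1 - s\<^sup>2)\<^sup>m \<le> 1\<close>, so a satisfied constraint costs at most
  \<open>C / m\<close>; for \<open>t < 0\<close> it bounds \<open>(1 - t / C)\<^sup>m\<close> below by \<open>- m t / C\<close>, so the term of a violated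
  constraint is at most \<open>- m t\<^sup>2 / C\<close>. Stating both in one inequality avoids a case
  distinction when the terms are summed.
\<close>

lemma penalty_le:
  fixes C t :: real
  assumes C: "C > 0" and t: "\<bar>t\<bar> \<le> C" and m: "m > 0"
  shows "t * (1 - t / C) ^ m \<le> C / real m - real m / C * (min t 0)\<^sup>2"
proof (cases "t \<ge> 0")
  case True
  define s where "s = t / C"
  have s: "0 \<le> s" "s \<le> 1"
    using True C t by (auto simp: s_def)
  have "(1 + real m * s) * (1 - s) ^ m \<le> (1 + s) ^ m * (1 - s) ^ m"
    using s Bernoulli_inequality [of s m] by (intro mult_right_mono) auto
  also have "\<dots> = ((1 + s) * (1 - s)) ^ m"
    by (simp add: power_mult_distrib)
  also have "\<dots> \<le> 1"
    using s by (intro power_le_one) (auto simp: algebra_simps mult_le_one)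
  finally have "(1 - s) ^ m + real m * s * (1 - s) ^ m \<le> 1"
    by (simp add: distrib_right)
  moreover have "(1 - s) ^ m \<ge> 0"
    using s by simp
  ultimately have "real m * s * (1 - s) ^ m \<le> 1"
    by linarith
  then have "C * s * (1 - s) ^ m \<le> C / real m"
    using m C by (simp add: pos_le_divide_eq mult_ac)
  then show ?thesis
    using True C by (simp add: s_def)
next
  case False
  have "0 \<le> - t / C"
    using False C by (simp add: divide_nonpos_pos)
  then have "- (real m * t / C) \<le> (1 - t / C) ^ m"
    using Bernoulli_inequality [of "- t / C" m] by simp
  then have "t * (1 - t / C) ^ m \<le> t * - (real m * t / C)"
    using False by (intro mult_left_mono_neg) auto
  also have "\<dots> = - (real m / C * (min t 0)\<^sup>2)"
    using False by (simp add: power2_eq_square)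
  also have "\<dots> \<le> C / real m - real m / C * (min t 0)\<^sup>2"
    using C by simp
  finally show ?thesis .
qed

text \<open>
  Subtracting \<open>t\<^sub>k\<close> times the even power of \<open>1 - t\<^sub>k / C\<close> turns positivity on the
  part of \<open>K\<close> cut out by the constraints \<open>t\<^sub>k \<ge> 0\<close> into positivity on all of \<open>K\<close>. If every
  exponent failed at some point, then by \<open>penalty_le\<close> an accumulation point of these
  points would violate no constraint, since otherwise \<open>F\<close> would be unbounded below near
  it; and \<open>F\<close> would be \<open>\<le> 0\<close> there.
\<close>

lemma penalized_pos_on_compact:
  fixes F :: "'x::metric_space \<Rightarrow> real" and t :: "'k \<Rightarrow> 'x \<Rightarrow> real"
  assumes K: "compact K" and contF: "continuous_on K F" and contt: "\<And>k. k \<in> I \<Longrightarrow> continuous_on K (t k)"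
    and I: "finite I" and C: "C > 0" "\<And>k x. k \<in> I \<Longrightarrow> x \<in> K \<Longrightarrow> \<bar>t k x\<bar> \<le> C"
    and pos: "\<And>x. x \<in> K \<Longrightarrow> (\<And>k. k \<in> I \<Longrightarrow> t k x \<ge> 0) \<Longrightarrow> F x > 0"
  shows "\<exists>N. \<forall>x\<in>K. F x - (\<Sum>k\<in>I. t k x * (1 - t k x / C) ^ (2 * N)) > 0"
proof (rule ccontr)
  assume contr: "\<not> ?thesis"
  define m where "m j = real (2 * Suc j)" for j
  define P where "P x = (\<Sum>k\<in>I. (min (t k x) 0)\<^sup>2)" for x
  have "\<exists>x\<in>K. F x \<le> (\<Sum>k\<in>I. t k x * (1 - t k x / C) ^ (2 * Suc j))" for j
    using contr by (auto simp: not_less simp del: mult_Suc_right)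
  then obtain x where x: "\<And>j. x j \<in> K" "\<And>j. F (x j) \<le> (\<Sum>k\<in>I. t k (x j) * (1 - t k (x j) / C) ^ (2 * Suc j))"
    by metis
  have m: "m j > 0" for j
    by (simp add: m_def)
  have bound: "F (x j) \<le> card I * (C / m j) - m j / C * P (x j)" for j
  proof -
    have "F (x j) \<le> (\<Sum>k\<in>I. C / m j - m j / C * (min (t k (x j)) 0)\<^sup>2)"
      unfolding m_def using C x(1)
      by (intro order.trans [OF x(2)] sum_mono penalty_le) auto
    then show ?thesis
      by (simp add: P_def sum_subtractf sum_distrib_left)
  qed
  obtain s r where s: "s \<in> K" and r: "strict_mono r" and lim: "(x \<circ> r) \<longlonglongrightarrow> s"
    using K x(1) by (meson compact_imp_seq_compact seq_compactE)
  have along: "(\<lambda>j. f (x (r j))) \<longlonglongrightarrow> f s" if "continuous_on K f" for f :: "'x \<Rightarrow> real"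
    using continuous_on_tendsto_compose [OF that lim s] x(1) by (simp add: o_def)
  have inv: "(\<lambda>j. 1 / m (r j)) \<longlonglongrightarrow> 0"
  proof -
    have "(\<lambda>j. 1 / m j) \<longlonglongrightarrow> 1 / 2 * 0"
      unfolding m_def using tendsto_mult [OF tendsto_const [of "1 / 2"] LIMSEQ_inverse_real_of_nat]
      by (simp add: field_simps)
    from LIMSEQ_subseq_LIMSEQ [OF this r] show ?thesis
      by (simp add: o_def)
  qed
  have "F s \<le> card I * (C * 0)"
  proof (rule LIMSEQ_le [OF along [OF contF]])
    show "(\<lambda>j. card I * (C * (1 / m (r j)))) \<longlonglongrightarrow> card I * (C * 0)"
      by (intro tendsto_intros inv)
    have "F (x j) \<le> card I * (C * (1 / m j))" for j
    proof -
      have "m j / C * P (x j) \<ge> 0"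
        using C(1) m [of j] by (simp add: P_def sum_nonneg)
      then show ?thesis
        using bound [of j] by simp
    qed
    then show "\<exists>N. \<forall>n\<ge>N. F (x (r n)) \<le> card I * (C * (1 / m (r n)))"
      by blast
  qed
  then have F_s: "F s \<le> 0"
    by simp
  have "P s \<le> C * (card I * (C * 0) - F s) * 0"
  proof (rule LIMSEQ_le)
    show "(\<lambda>j. P (x (r j))) \<longlonglongrightarrow> P s"
      unfolding P_def by (intro tendsto_intros along contt)
    show "(\<lambda>j. C * (card I * (C * (1 / m (r j))) - F (x (r j))) * (1 / m (r j)))
        \<longlonglongrightarrow> C * (card I * (C * 0) - F s) * 0"
      by (intro tendsto_intros inv along contF)
    have "P (x j) \<le> C * (card I * (C * (1 / m j)) - F (x j)) * (1 / m j)" for j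
    proof -
      have "m j / C * P (x j) \<le> card I * (C * (1 / m j)) - F (x j)"
        using bound [of j] by simp
      then have "C / m j * (m j / C * P (x j)) \<le> C / m j * (card I * (C * (1 / m j)) - F (x j))"
        using C(1) m [of j] by (intro mult_left_mono) auto
      then show ?thesis
        using C(1) m [of j] by simp
    qed
    then show "\<exists>N. \<forall>n\<ge>N. P (x (r n)) \<le> C * (card I * (C * (1 / m (r n))) - F (x (r n))) * (1 / m (r n))"
      by blast
  qed
  then have P_s: "P s \<le> 0"
    by simp
  have "t k s \<ge> 0" if "k \<in> I" for k
  proof -
    have "(min (t k s) 0)\<^sup>2 \<le> P s"
      unfolding P_def using I that by (intro member_le_sum) auto
    with P_s have "(min (t k s) 0)\<^sup>2 \<le> 0"
      by linarith
    then show ?thesis by (simp add: min_def split: if_splits)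
  qed
  then show False
    using pos [OF s] F_s by fastforce
qed

section \<open>The simplex\<close>

lemma sum_option_UNIV:
  fixes f :: "'a::finite option \<Rightarrow> 'b::comm_monoid_add"
  shows "(\<Sum>k\<in>UNIV. f k) = f None + (\<Sum>i\<in>UNIV. f (Some i))"
  by (simp add: UNIV_option_conv sum.reindex)

definition ball_constraint :: "real \<Rightarrow> ('n::finite) mpoly" where
  "ball_constraint M = mconst (M\<^sup>2) - (\<Sum>i\<in>UNIV. (mvar i)\<^sup>2) - (slack M)\<^sup>2"

lemma meval_slack: "meval (slack M) x = M - (\<Sum>i\<in>UNIV. x $ i)"
  by (simp add: slack_def meval_diff meval_sum)

lemma meval_ball_constraint:
  "meval (ball_constraint M) x = M\<^sup>2 - (\<Sum>i\<in>UNIV. (x $ i)\<^sup>2) - (M - (\<Sum>i\<in>UNIV. x $ i))\<^sup>2"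
  by (simp add: ball_constraint_def meval_diff meval_sum meval_power meval_slack)

text \<open>
  The ball constraint makes the module Archimedean, in the explicit form needed for
  the box: \<open>2 R (R + y) = (R + y)\<^sup>2 + (R\<^sup>2 - y\<^sup>2)\<close>, and with \<open>y\<^sup>2 = x\<^sub>i\<^sup>2\<close> the last term is the
  constraint plus the nonnegative constant \<open>R\<^sup>2 - M\<^sup>2\<close>, the squares of the other
  variables and the square of the slack.
\<close>

lemma box_bound_in_sos_module:
  fixes i :: "'n::finite" and R :: real
  assumes y: "y = mvar i \<or> y = - mvar i" and R: "R > \<bar>M\<bar>"
  shows "mconst R + y \<in> sos_module (ball_constraint M)"
proof -
  let ?T = "sos_module (ball_constraint M :: 'n mpoly)"
  have y2: "y\<^sup>2 = (mvar i)\<^sup>2"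
    using y by auto
  have R0: "R > 0" using R by linarith
  have "M\<^sup>2 \<le> R\<^sup>2"
    using R by (intro abs_le_square_iff [THEN iffD1]) auto
  have split: "(\<Sum>j\<in>UNIV. (mvar j)\<^sup>2) = (mvar i)\<^sup>2 + (\<Sum>j\<in>UNIV - {i}. (mvar j :: 'n mpoly)\<^sup>2)"
    by (rule sum.remove) auto
  have "is_sos (mconst (R\<^sup>2 - M\<^sup>2) + (mconst R + y)\<^sup>2 + (\<Sum>j\<in>UNIV - {i}. (mvar j)\<^sup>2) + (slack M)\<^sup>2)"
    using \<open>M\<^sup>2 \<le> R\<^sup>2\<close> by (intro is_sos_add is_sos_sum is_sos_power2 is_sos_mconst) auto
  then have "mconst (R\<^sup>2 - M\<^sup>2) + (mconst R + y)\<^sup>2 + (\<Sum>j\<in>UNIV - {i}. (mvar j)\<^sup>2) + (slack M)\<^sup>2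
      + ball_constraint M \<in> ?T"
    by (intro sos_module_add generator_in_sos_module is_sos_in_sos_module)
  also have "mconst (R\<^sup>2 - M\<^sup>2) + (mconst R + y)\<^sup>2 + (\<Sum>j\<in>UNIV - {i}. (mvar j)\<^sup>2) + (slack M)\<^sup>2
      + ball_constraint M = mconst (2 * R) * (mconst R + y)"
  proof -
    have "mconst (2 * R) = (mconst R + mconst R :: 'n mpoly)"
      by (simp flip: mconst_add)
    then show ?thesis
      unfolding ball_constraint_def split
      by (simp only: mconst_diff mconst_power power2_sum y2) (simp add: power2_eq_square algebra_simps)
  qed
  finally have "mconst (2 * R) * (mconst R + y) \<in> ?T" .
  moreover have "mconst (1 / (2 * R)) \<in> ?T"
    using R0 by (intro is_sos_in_sos_module is_sos_mconst) simp
  ultimately have "mconst (1 / (2 * R)) * (mconst (2 * R) * (mconst R + y)) \<in> ?T"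
    by (rule sos_module_mult [rotated])
  also have "mconst (1 / (2 * R)) * (mconst (2 * R) * (mconst R + y)) = mconst R + y"
    using R0 by (simp add: mult.assoc [symmetric] flip: mconst_mult)
  finally show ?thesis .
qed

theorem lemma4:
  fixes M :: real and d :: nat and F :: "('n::finite) mpoly"
  assumes "total_degree F \<le> d"
    and "\<forall>x \<in> corner_simplex M. meval F x > 0"
  shows "\<exists>(\<sigma>\<^sub>0 :: 'n mpoly) (\<sigma>\<^sub>1 :: 'n mpoly) (\<rho> :: 'n \<Rightarrow> real poly) (\<rho>' :: real poly).
    is_sos \<sigma>\<^sub>0 \<and> is_sos \<sigma>\<^sub>1 \<and> (\<forall>i. is_sos (\<rho> i)) \<and> is_sos \<rho>' \<and>
    F = \<sigma>\<^sub>0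
      + \<sigma>\<^sub>1 * (mconst (M\<^sup>2) - (\<Sum>i\<in>UNIV. (mvar i)\<^sup>2) - (slack M)\<^sup>2)
      + msubst \<rho>' (slack M) * slack M
      + (\<Sum>i\<in>UNIV. msubst (\<rho> i) (mvar i) * mvar i)"
proof -
  let ?g = "ball_constraint M :: 'n mpoly"
  \<comment> \<open>All \<open>n + 2\<close> constraints as one family: the ball, the slack and the variables.\<close>
  define t :: "'n option option \<Rightarrow> 'n mpoly"
    where "t k = (case k of None \<Rightarrow> ?g | Some None \<Rightarrow> slack M | Some (Some i) \<Rightarrow> mvar i)" for k
  \<comment> \<open>The summand \<open>1\<close> keeps the box nondegenerate when \<open>M = 0\<close>.\<close>
  define R where "R = \<bar>M\<bar> + 1"
  define K :: "(real ^ 'n) set" where "K = cbox (\<chi> i. - R) (\<chi> i. R)"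
  have K: "compact K"
    by (simp add: K_def)
  have "\<exists>b. \<forall>x\<in>K. \<bar>meval (t k) x\<bar> \<le> b" for k
    using compact_imp_bounded [OF compact_continuous_image [OF continuous_on_meval K], of "t k"]
    by (auto simp: bounded_iff)
  then obtain b where b: "\<And>k x. x \<in> K \<Longrightarrow> \<bar>meval (t k) x\<bar> \<le> b k"
    by metis
  define C where "C = 1 + (\<Sum>k\<in>UNIV. \<bar>b k\<bar>)"
  have C: "C > 0"
    by (simp add: C_def add_pos_nonneg sum_nonneg)
  have tC: "\<bar>meval (t k) x\<bar> \<le> C" if "x \<in> K" for k x
  proof -
    have "\<bar>b k\<bar> \<le> (\<Sum>k\<in>UNIV. \<bar>b k\<bar>)"
      by (rule member_le_sum) auto
    then show ?thesis
      using b [OF that, of k] by (simp add: C_def)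
  qed
  have pos: "meval F x > 0" if "\<And>k. meval (t k) x \<ge> 0" for x
  proof -
    have "x $ i \<ge> 0" for i
      using that [of "Some (Some i)"] by (simp add: t_def)
    moreover have "(\<Sum>i\<in>UNIV. x $ i) \<le> M"
      using that [of "Some None"] by (simp add: t_def meval_slack)
    ultimately show ?thesis
      using assms(2) by (simp add: corner_simplex_def)
  qed
  have "\<exists>N. \<forall>x\<in>K. meval F x - (\<Sum>k\<in>UNIV. meval (t k) x * (1 - meval (t k) x / C) ^ (2 * N)) > 0"
    by (rule penalized_pos_on_compact) (auto intro: K continuous_on_meval C tC pos)
  then obtain N where N: "\<And>x. x \<in> K \<Longrightarrow>
      meval F x - (\<Sum>k\<in>UNIV. meval (t k) x * (1 - meval (t k) x / C) ^ (2 * N)) > 0"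
    by blast
  \<comment> \<open>The penalty factor depends on its constraint alone, so one univariate square serves all of them.\<close>
  define \<rho> :: "real poly" where "\<rho> = ([:1, - (1 / C):] ^ N)\<^sup>2"
  have \<rho>: "is_sos \<rho>"
    unfolding \<rho>_def by (rule is_sos_power2)
  have msubst_\<rho>: "msubst \<rho> q = ((1 - mconst (1 / C) * q) ^ N)\<^sup>2" for q :: "'n mpoly"
    by (simp add: \<rho>_def msubst_power msubst_pCons mconst_uminus mult.commute)
  define G where "G = F - (\<Sum>k\<in>UNIV. msubst \<rho> (t k) * t k)"
  have "G \<in> sos_module ?g"
  proof (rule positive_on_box_in_cone [where R = R])
    show "mconst R + mvar i \<in> sos_module ?g" "mconst R - mvar i \<in> sos_module ?g" for i
      using box_bound_in_sos_module [of "mvar i" i M R] box_bound_in_sos_module [of "- mvar i" i M R]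
      by (simp_all add: R_def)
    show "meval G x > 0" if "\<forall>i. \<bar>x $ i\<bar> \<le> R" for x
    proof -
      have "x \<in> K"
        using that by (auto simp: K_def mem_box_cart abs_le_iff minus_le_iff)
      from N [OF this] show ?thesis
        by (simp add: G_def msubst_\<rho> meval_diff meval_sum meval_mult meval_power mult.commute
            flip: power_mult)
    qed
  qed (auto simp: R_def intro: sos_module_add sos_module_mult is_sos_in_sos_module is_sos_mconst)
  then obtain \<sigma> \<tau> where \<sigma>: "is_sos \<sigma>" and \<tau>: "is_sos \<tau>" and G: "G = \<sigma> + \<tau> * ?g"
    by (auto simp: sos_module_def)
  \<comment> \<open>The penalty of the ball constraint is absorbed into its sum of squares multiplier.\<close>
  have "F = G + (\<Sum>k\<in>UNIV. msubst \<rho> (t k) * t k)"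
    by (simp add: G_def)
  also have "\<dots> = \<sigma> + (\<tau> + msubst \<rho> ?g) * ?g + msubst \<rho> (slack M) * slack M
      + (\<Sum>i\<in>UNIV. msubst \<rho> (mvar i) * mvar i)"
    by (simp add: G sum_option_UNIV t_def algebra_simps)
  finally have "F = \<sigma> + (\<tau> + msubst \<rho> ?g) * ?g + msubst \<rho> (slack M) * slack M
      + (\<Sum>i\<in>UNIV. msubst \<rho> (mvar i) * mvar i)" .
  moreover have "is_sos (\<tau> + msubst \<rho> ?g)"
    unfolding msubst_\<rho> by (intro is_sos_add \<tau> is_sos_power2)
  ultimately show ?thesis
    unfolding ball_constraint_def using \<sigma> \<rho> 
    by (intro exI [of _ \<sigma>] exI [of _ "\<tau> + msubst \<rho> ?g"] exI [of _ "\<lambda>_. \<rho>"] exI [of _ \<rho>])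
       (simp add: ball_constraint_def)
qed

end
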